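(* For every real number $x$ with $0<|x|\le 4$, put \[ y = y(x) = \frac{\sqrt{x^2+16}-4}{x}. \] Then \[ \sum_{n=0}^\infty \frac{(-1)^n}{(2n+1)^2}\binom{4n+2}{2n+1}^{-1}x^{2n+1} = 4\operatorname{arctanh}\sqrt{y}\,\arctan\sqrt{y}, \] \[ \sum_{n=0}^\infty \frac{(-1)^n}{2n+1}\binom{4n+2}{2n+1}^{-1}x^{2n+1} = \frac{2\sqrt{y}\,(1-y^2)}{1+y^2}\left(\frac{\operatorname{arctanh}\sqrt{y}}{1+y}+\frac{\arctan\sqrt{y}}{1-y}\right), \] and \[ \begin{aligned} \sum_{n=0}^\infty (-1)^n\binom{4n+2}{2n+1}^{-1}x^{2n+1} &= \frac{2y(1-y^2)}{(1+y^2)^2} + \frac{(1+y)(1-y)^2(y^2+4y+1)}{(1+y^2)^3}\sqrt{y}\,\arctan\sqrt{y}\\ &\quad + \frac{(1-y)(1+y)^2(y^2-4y+1)}{(1+y^2)^3}\sqrt{y}\,\operatorname{arctanh}\sqrt{y}. \end{aligned} \]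
   Context: When $y<0$ (i.e. $x<0$), $\sqrt{y}$ is non-real; square roots, $\arctan$ and $\operatorname{arctanh}$ of non-real arguments denote the principal branches.
   Formalization: The third identity is stated only for 0<|x|<4: at |x|=4 its series diverges, since binom(4n+2,2n+1) ≤ 4^(2n+1) makes every term at least 1 in absolute value. The first two identities hold on all of 0<|x|≤4 as stated. *)

theory Defs
  imports "HOL-Analysis.Analysis"
begin

text \<open>
  The series without a factor \<open>2 * n + 1\<close> in the denominator diverges for \<open>\<bar>x\<bar> = 4\<close>, since
  each of its terms has absolute value at least 1. Its closed form can hence only be claimed
  for \<open>\<bar>x\<bar> < 4\<close>; the other two series also converge at \<open>\<bar>x\<bar> = 4\<close>.
\<close>

lemma not_summable_boundary:
  fixes x :: real
  assumes "\<bar>x\<bar> = 4"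
  shows "\<not> summable (\<lambda>n. (-1) ^ n * inverse (real ((4 * n + 2) choose (2 * n + 1))) * x ^ (2 * n + 1))"
    (is "\<not> summable ?f")
proof
  assume "summable ?f"
  then have "?f \<longlonglongrightarrow> 0"
    by (rule summable_LIMSEQ_zero)
  then have "eventually (\<lambda>n. \<bar>?f n\<bar> < 1) sequentially"
    by (auto simp: tendsto_iff dist_real_def dest: spec[of _ 1])
  then obtain n where n: "\<bar>?f n\<bar> < 1"
    by (auto simp: eventually_sequentially)
  let ?b = "(4 * n + 2) choose (2 * n + 1)"
  have "?b \<le> 2 ^ (4 * n + 2)"
    by (rule binomial_le_pow2)
  also have "(2::nat) ^ (4 * n + 2) = 4 ^ (2 * n + 1)"
    using power_mult[of "2::nat" 2 "2 * n + 1"] by (simp add: algebra_simps)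
  finally have "real ?b \<le> 4 ^ (2 * n + 1)"
    by (metis of_nat_le_iff of_nat_numeral of_nat_power)
  moreover have "real ?b > 0"
    by (simp only: of_nat_0_less_iff zero_less_binomial_iff)
  ultimately have "1 \<le> 4 ^ (2 * n + 1) / real ?b"
    by (simp only: le_divide_eq_1_pos)
  also have "\<dots> = \<bar>?f n\<bar>"
    using assms by (simp only: abs_mult abs_inverse power_abs abs_of_nat abs_minus_cancel abs_one power_one divide_inverse mult_1 mult.commute)
  finally have "1 \<le> \<bar>?f n\<bar>" .
  then show False
    using n by linarith
qed

end

theory Submission
  imports Defs
begin

text \<open>
  With $m = 2n+1$ and $z = ix$, the first two series are the odd parts, divided by $i$, of
  $\sum_m z^m / (m^k \binom{2m}{m})$ for $k = 2, 1$, and the third is that of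
  $\sum_{m \ge 1} z^m / \binom{2m}{m}$. The recurrence
  $2(2m+1)\binom{2m}{m} = (m+1)\binom{2m+2}{m+1}$ turns into a first-order linear differential
  equation for the series with $k = 1$. Parametrising $z = 8is^2/(1-s^4)$ with $s^2 = y$
  rationalises it: $4 - z = 4(1-is^2)^2/(1-s^4)$ is essentially a square, and
  $\arcsin(\sqrt z/2) = \arctan s + i \operatorname{artanh} s =: w$. The series with $k = 2$ becomes
  $2w^2$, the one with $k = 1$ becomes $2(1+i)sw/(1-is^2)$, and the remaining one follows from the
  differential equation without integration. As $s \mapsto is$ sends $z$ to $-z$, the odd parts
  can be read off for all complex $s$ at once, so negative $x$ needs no separate treatment.

  On the circle $|x| = 4$ the first two series alternate with decreasing terms, so their partial
  sums enclose the closed form for $|x| < 4$; this persists in the limit.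
\<close>

text \<open>The inverse of 0 being 0, these coefficients vanish at index 0.\<close>

definition cb_coeff1 :: "nat \<Rightarrow> complex" where
  "cb_coeff1 m = inverse (of_nat m * of_nat ((2 * m) choose m))"

definition cb_coeff2 :: "nat \<Rightarrow> complex" where
  "cb_coeff2 m = inverse (of_nat m ^ 2 * of_nat ((2 * m) choose m))"

lemma cb_coeff1_0 [simp]: "cb_coeff1 0 = 0"
  by (simp add: cb_coeff1_def)

lemma cb_coeff2_0 [simp]: "cb_coeff2 0 = 0"
  by (simp add: cb_coeff2_def)

lemma cb_coeff1_1 [simp]: "cb_coeff1 (Suc 0) = 1 / 2"
  by (simp add: cb_coeff1_def numeral_2_eq_2)

lemma central_binomial_Suc:
  "Suc n * ((2 * Suc n) choose (Suc n)) = 2 * (2 * n + 1) * ((2 * n) choose n)"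
proof -
  have "Suc n * ((2 * Suc n) choose (Suc n)) = 2 * Suc n * (Suc (2 * n) choose n)"
    using Suc_times_binomial[of n "Suc (2 * n)"] by simp
  also have "Suc (2 * n) choose n = Suc (2 * n) choose Suc n"
    using binomial_symmetric[of n "Suc (2 * n)"] by (simp add: Suc_diff_le)
  also have "2 * Suc n * (Suc (2 * n) choose Suc n) = 2 * (Suc (2 * n) * ((2 * n) choose n))"
    using Suc_times_binomial[of n "2 * n"] by (simp only: mult.assoc)
  finally show ?thesis
    by simp
qed

lemma cb_coeff1_Suc:
  assumes "n > 0"
  shows "2 * (2 * of_nat n + 1) * cb_coeff1 (Suc n) = of_nat n * cb_coeff1 n"
proof -
  have eq: "of_nat (Suc n) * of_nat ((2 * Suc n) choose (Suc n)) =
      (2 * (2 * of_nat n + 1) * of_nat ((2 * n) choose n) :: complex)"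
    using arg_cong[OF central_binomial_Suc[of n], of "of_nat :: nat \<Rightarrow> complex"]
    by (simp only: of_nat_mult of_nat_add of_nat_numeral of_nat_1)
  have "(2 * of_nat n + 1 :: complex) \<noteq> 0"
    using of_nat_neq_0[of "2 * n", where 'a = complex] by (simp add: add.commute)
  then show ?thesis
    using assms unfolding cb_coeff1_def eq by (simp del: distrib_left_numeral add: mult.assoc)
qed

lemma norm_cb_coeff1_le: "norm (cb_coeff1 m) \<le> 2 * (1 / 4) ^ m"
proof (cases "m = 0")
  case False
  then have "4 ^ m / (2 * real m) \<le> real ((2 * m) choose m)"
    by (intro central_binomial_lower_bound) simp
  then have "4 ^ m / 2 \<le> real m * real ((2 * m) choose m)"
    using False by (simp add: field_simps)
  then have "inverse (real m * real ((2 * m) choose m)) \<le> inverse (4 ^ m / 2)"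
    by (intro le_imp_inverse_le) auto
  also have "inverse (4 ^ m / 2) = 2 * (1 / 4 :: real) ^ m"
    by (simp add: power_divide)
  finally show ?thesis
    by (simp only: cb_coeff1_def norm_inverse norm_mult norm_of_nat)
qed simp

lemma summable_cb_coeff1:
  assumes "norm z < 4"
  shows "summable (\<lambda>n. cb_coeff1 n * z ^ n)"
proof (rule summable_comparison_test')
  show "summable (\<lambda>n. 2 * (norm z / 4) ^ n)"
    using assms by (intro summable_mult summable_geometric) auto
  show "norm (cb_coeff1 n * z ^ n) \<le> 2 * (norm z / 4) ^ n" for n
    using mult_right_mono[OF norm_cb_coeff1_le[of n], of "norm z ^ n"]
    by (simp add: norm_mult norm_power power_divide)
qed

lemma norm_cb_coeff2_le: "norm (cb_coeff2 m) \<le> norm (cb_coeff1 m)"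
proof (cases "m = 0")
  case False
  have "norm (cb_coeff2 m) = norm (cb_coeff1 m) / m"
    by (simp add: cb_coeff2_def cb_coeff1_def norm_inverse norm_mult power2_eq_square divide_inverse)
  also have "\<dots> \<le> norm (cb_coeff1 m) / 1"
    using False by (intro divide_left_mono) auto
  finally show ?thesis by simp
qed simp

lemma summable_cb_coeff2:
  assumes "norm z < 4"
  shows "summable (\<lambda>n. cb_coeff2 n * z ^ n)"
proof (rule summable_comparison_test')
  show "summable (\<lambda>n. 2 * (norm z / 4) ^ n)"
    using assms by (intro summable_mult summable_geometric) auto
  show "norm (cb_coeff2 n * z ^ n) \<le> 2 * (norm z / 4) ^ n" for n
    using mult_right_mono[OF order.trans[OF norm_cb_coeff2_le norm_cb_coeff1_le[of n]], of "norm z ^ n"]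
    by (simp add: norm_mult norm_power power_divide)
qed

definition cb_series1 :: "complex \<Rightarrow> complex" where
  "cb_series1 z = (\<Sum>n. cb_coeff1 (Suc n) * z ^ n)"

definition cb_series1' :: "complex \<Rightarrow> complex" where
  "cb_series1' z = (\<Sum>n. diffs (\<lambda>n. cb_coeff1 (Suc n)) n * z ^ n)"

definition cb_series2 :: "complex \<Rightarrow> complex" where
  "cb_series2 z = (\<Sum>n. cb_coeff2 n * z ^ n)"

lemma summable_cb_coeff1_Suc: "norm z < 4 \<Longrightarrow> summable (\<lambda>n. cb_coeff1 (Suc n) * z ^ n)"
  by (rule powser_split_head(3)[OF summable_cb_coeff1])

lemma sums_cb_coeff1:
  assumes "norm z < 4"
  shows "(\<lambda>n. cb_coeff1 n * z ^ n) sums (z * cb_series1 z)"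
proof -
  have "(\<lambda>n. z * (cb_coeff1 (Suc n) * z ^ n)) sums (z * cb_series1 z)"
    unfolding cb_series1_def by (intro sums_mult summable_sums summable_cb_coeff1_Suc assms)
  also have "(\<lambda>n. z * (cb_coeff1 (Suc n) * z ^ n)) = (\<lambda>n. cb_coeff1 (Suc n) * z ^ Suc n)"
    by (simp add: mult_ac)
  finally show ?thesis
    by (rule sums_Suc_imp[rotated]) simp
qed

lemma cb_series1_deriv:
  "norm z < 4 \<Longrightarrow> (cb_series1 has_field_derivative cb_series1' z) (at z)"
  unfolding cb_series1_def [abs_def] cb_series1'_def
  by (rule termdiffs_strong'[OF summable_cb_coeff1_Suc])

lemma cb_series2_deriv:
  assumes "norm z < 4"
  shows "(cb_series2 has_field_derivative cb_series1 z) (at z)"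
proof -
  have "diffs cb_coeff2 = (\<lambda>n. cb_coeff1 (Suc n))"
    by (simp add: diffs_def cb_coeff1_def cb_coeff2_def power2_eq_square field_simps del: of_nat_Suc binomial_Suc_Suc)
  then show ?thesis
    using termdiffs_strong'[OF summable_cb_coeff2 assms]
    by (simp add: cb_series2_def [abs_def] cb_series1_def [abs_def])
qed

lemma sums_cb_coeff0:
  assumes "norm z < 4"
  shows "(\<lambda>n. of_nat n * cb_coeff1 n * z ^ n) sums (z * (cb_series1 z + z * cb_series1' z))"
    and "(\<lambda>n. of_nat (Suc n) * cb_coeff1 (Suc n) * z ^ n) sums (cb_series1 z + z * cb_series1' z)"
proof -
  have "summable (\<lambda>n. diffs (\<lambda>n. cb_coeff1 (Suc n)) n * z ^ n)"
    using termdiff_converges[OF assms summable_cb_coeff1_Suc] by simp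
  then have "(\<lambda>n. of_nat n * cb_coeff1 (Suc n) * z ^ (n - Suc 0)) sums cb_series1' z"
    unfolding cb_series1'_def by (rule diffs_equiv)
  then have "(\<lambda>n. z * (of_nat n * cb_coeff1 (Suc n) * z ^ (n - Suc 0))) sums (z * cb_series1' z)"
    by (rule sums_mult)
  also have "(\<lambda>n. z * (of_nat n * cb_coeff1 (Suc n) * z ^ (n - Suc 0))) = (\<lambda>n. of_nat n * cb_coeff1 (Suc n) * z ^ n)"
  proof
    fix n
    show "z * (of_nat n * cb_coeff1 (Suc n) * z ^ (n - Suc 0)) = of_nat n * cb_coeff1 (Suc n) * z ^ n"
      by (cases n) auto
  qed
  finally have "(\<lambda>n. cb_coeff1 (Suc n) * z ^ n + of_nat n * cb_coeff1 (Suc n) * z ^ n) sums (cb_series1 z + z * cb_series1' z)"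
    unfolding cb_series1_def by (intro sums_add summable_sums summable_cb_coeff1_Suc assms)
  then show *: "(\<lambda>n. of_nat (Suc n) * cb_coeff1 (Suc n) * z ^ n) sums (cb_series1 z + z * cb_series1' z)"
    by (simp add: algebra_simps)
  show "(\<lambda>n. of_nat n * cb_coeff1 n * z ^ n) sums (z * (cb_series1 z + z * cb_series1' z))"
    by (rule sums_Suc_imp) (use sums_mult[OF *, of z] in \<open>simp_all add: mult_ac\<close>)
qed

lemma cb_series1_ode:
  assumes "norm z < 4"
  shows "(4 - z) * (cb_series1 z + z * cb_series1' z) = 2 * cb_series1 z + 1"
proof -
  let ?G = "cb_series1 z + z * cb_series1' z"
  have "(\<lambda>n. 4 * (of_nat (Suc n) * cb_coeff1 (Suc n) * z ^ n) - of_nat n * cb_coeff1 n * z ^ n) sums (4 * ?G - z * ?G)"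
    by (intro sums_diff sums_mult sums_cb_coeff0 assms)
  also have "(\<lambda>n. 4 * (of_nat (Suc n) * cb_coeff1 (Suc n) * z ^ n) - of_nat n * cb_coeff1 n * z ^ n) =
      (\<lambda>n. 2 * (cb_coeff1 (Suc n) * z ^ n) + (if n = 0 then 1 else 0))"
  proof
    fix n
    show "4 * (of_nat (Suc n) * cb_coeff1 (Suc n) * z ^ n) - of_nat n * cb_coeff1 n * z ^ n =
       2 * (cb_coeff1 (Suc n) * z ^ n) + (if n = 0 then 1 else 0)"
    proof (cases "n = 0")
      case False
      then have "of_nat n * cb_coeff1 n = 2 * (2 * of_nat n + 1) * cb_coeff1 (Suc n)"
        by (intro cb_coeff1_Suc [symmetric]) simp
      then show ?thesis using False by (simp add: algebra_simps)
    qed simp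
  qed
  finally have "(\<lambda>n. 2 * (cb_coeff1 (Suc n) * z ^ n) + (if n = 0 then 1 else 0)) sums (4 * ?G - z * ?G)" .
  moreover have "(\<lambda>n. 2 * (cb_coeff1 (Suc n) * z ^ n) + (if n = 0 then 1 else 0)) sums (2 * cb_series1 z + 1)"
    unfolding cb_series1_def
    by (intro sums_add sums_mult summable_sums summable_cb_coeff1_Suc assms) (use sums_single[of 0 "\<lambda>_. 1::complex"] in simp)
  ultimately have "4 * ?G - z * ?G = 2 * cb_series1 z + 1"
    by (rule sums_unique2)
  then show ?thesis
    by (simp only: left_diff_distrib)
qed

lemma Arctan_minus:
  assumes "norm z < 1"
  shows "Arctan (-z) = - Arctan z"
proof -
  have "(1 - \<i> * z) / (1 + \<i> * z) \<notin> \<real>\<^sub>\<le>\<^sub>0"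
    using assms Re_complex_div_lemma[of z] by (auto simp: complex_nonpos_Reals_iff)
  from Ln_inverse[OF this] show ?thesis
    by (simp add: Arctan_def)
qed

lemma artanh_conv_Arctan: "artanh z = - \<i> * Arctan (\<i> * z)"
proof -
  have "\<i> * (\<i> * z) = -z" by (simp flip: mult.assoc)
  then show ?thesis by (simp add: artanh_def Arctan_def flip: mult.assoc)
qed

definition cb_arcsin :: "complex \<Rightarrow> complex" where
  "cb_arcsin s = Arctan s + Arctan (\<i> * s)"

definition cb_arg :: "complex \<Rightarrow> complex" where
  "cb_arg s = 8 * \<i> * s ^ 2 / (1 - s ^ 4)"

text \<open>
  The condition \<open>\<bar>s\<bar>\<^sup>4 + 2 \<bar>s\<bar>\<^sup>2 < 1\<close> describes the largest disc around 0 on which the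
  triangle inequality gives \<open>\<bar>z\<bar> < 4\<close>; for \<open>s\<^sup>2 = y\<close> real it is equivalent to \<open>\<bar>x\<bar> < 4\<close>.
\<close>

lemma cb_arg_domain:
  assumes "norm (s::complex) ^ 4 + 2 * norm s ^ 2 < 1"
  shows "norm s < 1" "norm (cb_arg s) < 4" "1 - s ^ 4 \<noteq> 0" "1 - \<i> * s ^ 2 \<noteq> 0" "1 + \<i> * s ^ 2 \<noteq> 0"
    "4 - cb_arg s = 4 * (1 - \<i> * s ^ 2) ^ 2 / (1 - s ^ 4)"
proof -
  have 1: "norm s ^ 4 < 1"
    using assms by (smt (verit) zero_le_power norm_ge_zero)
  show "norm s < 1"
    using 1 by (smt (verit) one_le_power)
  have 2: "norm s ^ 2 < 1"
    using assms by (smt (verit) zero_le_power norm_ge_zero)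
  have 3: "1 - norm s ^ 4 \<le> norm (1 - s ^ 4)"
    using norm_triangle_ineq2[of 1 "s ^ 4"] by (simp add: norm_power)
  show nz: "1 - s ^ 4 \<noteq> 0"
    using 1 3 by auto
  have "norm (\<i> * s\<^sup>2) < 1"
    using 2 by (simp add: norm_mult norm_power)
  then show nz2: "1 - \<i> * s ^ 2 \<noteq> 0" "1 + \<i> * s ^ 2 \<noteq> 0"
    by (auto simp: add_eq_0_iff)
  have "norm (cb_arg s) = 8 * norm s ^ 2 / norm (1 - s ^ 4)"
    by (simp add: cb_arg_def norm_mult norm_divide norm_power)
  also have "\<dots> < 4"
    using nz assms 3 by (simp add: divide_less_eq)
  finally show "norm (cb_arg s) < 4" .
  have i4: "(1 - \<i> * s ^ 2) ^ 2 = 1 - s ^ 4 - 2 * \<i> * s ^ 2"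
    by (simp add: power2_eq_square algebra_simps eval_nat_numeral)
  show "4 - cb_arg s = 4 * (1 - \<i> * s ^ 2) ^ 2 / (1 - s ^ 4)"
    unfolding i4 using nz by (simp add: cb_arg_def field_simps)
qed

lemma cb_arcsin_deriv:
  assumes "norm (s::complex) < 1"
  shows "(cb_arcsin has_field_derivative ((1 + \<i>) * (1 + \<i> * s ^ 2) / (1 - s ^ 4))) (at s)"
proof -
  have "norm (s ^ 2) < 1"
    using assms by (simp add: norm_power abs_square_less_1)
  then have nz: "1 + s ^ 2 \<noteq> 0" "1 - s ^ 2 \<noteq> 0"
    by (auto simp: add_eq_0_iff)
  have fac: "1 - s ^ 4 = (1 + s ^ 2) * (1 - s ^ 2)"
    by (simp add: algebra_simps eval_nat_numeral)
  have abs: "\<bar>Im s\<bar> < 1" "\<bar>Re s\<bar> < 1"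
    using assms abs_Im_le_cmod abs_Re_le_cmod order.strict_trans1 by blast+
  have eq: "inverse (1 + s ^ 2) + inverse (1 + (\<i> * s) ^ 2) * \<i> = (1 + \<i>) * (1 + \<i> * s ^ 2) / (1 - s ^ 4)"
    unfolding fac using nz by (simp add: field_simps power_mult_distrib)
  have "((\<lambda>z. Arctan (\<i> * z)) has_field_derivative inverse (1 + (\<i> * s) ^ 2) * \<i>) (at s)"
    by (rule DERIV_chain2[OF has_field_derivative_Arctan])
       (use abs in \<open>auto intro!: derivative_eq_intros\<close>)
  from DERIV_add[OF has_field_derivative_Arctan this] show ?thesis
    unfolding cb_arcsin_def [abs_def] eq using abs by simp
qed

lemma cb_arg_deriv:
  assumes "1 - s ^ 4 \<noteq> 0"
  shows "(cb_arg has_field_derivative (16 * \<i> * s * (1 + s ^ 4) / (1 - s ^ 4) ^ 2)) (at s)"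
  unfolding cb_arg_def [abs_def]
  apply (rule derivative_eq_intros refl)+
  using assms apply simp
  using assms apply (simp add: divide_simps)
  apply (simp add: algebra_simps eval_nat_numeral)
  done

lemma cb_series1_cb_arg:
  assumes "norm (s::complex) ^ 4 + 2 * norm s ^ 2 < 1"
  shows "8 * \<i> * s * (1 - \<i> * s ^ 2) / (1 - s ^ 4) * cb_series1 (cb_arg s) = 2 * (1 + \<i>) * cb_arcsin s"
proof -
  let ?E = "\<lambda>s. 8 * \<i> * s * (1 - \<i> * s ^ 2) / (1 - s ^ 4) * cb_series1 (cb_arg s) - 2 * (1 + \<i>) * cb_arcsin s"
  have "\<exists>c. \<forall>u\<in>cball 0 (norm s). ?E u = c"
  proof (rule has_field_derivative_zero_constant)
    fix u :: complex assume "u \<in> cball 0 (norm s)"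
    then have "norm u ^ 4 + 2 * norm u ^ 2 \<le> norm s ^ 4 + 2 * norm s ^ 2"
      by (intro add_mono mult_left_mono power_mono) auto
    then have u: "norm u ^ 4 + 2 * norm u ^ 2 < 1" using assms by simp
    note nb = cb_arg_domain[OF u]
    let ?B = "cb_series1 (cb_arg u)" and ?B' = "cb_series1' (cb_arg u)" and ?z = "cb_arg u"
    define d where "d = 1 - u ^ 4"
    define z' where "z' = 16 * \<i> * u * (1 + u ^ 4) / d ^ 2"
    have d: "d \<noteq> 0" using nb d_def by simp
    have q: "((\<lambda>s. 8 * \<i> * s * (1 - \<i> * s ^ 2) / (1 - s ^ 4)) has_field_derivative
       8 * \<i> * (1 - 3 * \<i> * u ^ 2 + 3 * u ^ 4 - \<i> * u ^ 6) / d ^ 2) (at u)"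
      apply (rule derivative_eq_intros refl)+
      using nb apply simp
      using nb apply (simp add: divide_simps d_def)
      apply (simp add: algebra_simps eval_nat_numeral)
      done
    have B: "((\<lambda>s. cb_series1 (cb_arg s)) has_field_derivative ?B' * z') (at u)"
      using DERIV_chain2[OF cb_series1_deriv cb_arg_deriv] nb by (simp add: z'_def d_def)
    have ode: "?z * (4 - ?z) * ?B' = (?z - 2) * ?B + 1"
      using cb_series1_ode[OF nb(2)] by (simp add: algebra_simps)
    have e1: "8 * \<i> * u * (1 - \<i> * u ^ 2) / d * z' = ?z * (4 - ?z) * (4 * \<i> * (1 + \<i> * u ^ 2) / d)"
    proof -
      have "8 * \<i> * u * (1 - \<i> * u ^ 2) * (16 * \<i> * u * (1 + u ^ 4)) = 
        8 * \<i> * u ^ 2 * (4 * (1 - \<i> * u ^ 2) ^ 2) * (4 * \<i> * (1 + \<i> * u ^ 2))"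
        by (simp add: algebra_simps eval_nat_numeral)
      then show ?thesis
        unfolding nb(6) unfolding cb_arg_def z'_def d_def[symmetric] using d
        by (simp add: field_simps eval_nat_numeral)
    qed
    have e2: "8 * \<i> * (1 - 3 * \<i> * u ^ 2 + 3 * u ^ 4 - \<i> * u ^ 6) / d ^ 2 + 4 * \<i> * (1 + \<i> * u ^ 2) / d * (?z - 2) = 0"
    proof -
      have "?z - 2 = (8 * \<i> * u ^ 2 - 2 * (1 - u ^ 4)) / d"
        using d by (simp add: cb_arg_def d_def field_simps)
      moreover have "8 * \<i> * (1 - 3 * \<i> * u ^ 2 + 3 * u ^ 4 - \<i> * u ^ 6) + 4 * \<i> * (1 + \<i> * u ^ 2) * (8 * \<i> * u ^ 2 - 2 * (1 - u ^ 4)) = 0"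
        by (simp add: algebra_simps eval_nat_numeral)
      moreover have "A / d ^ 2 + P / d * (N / d) = (A + P * N) / d ^ 2" for A P N
        by (simp add: power2_eq_square add_divide_distrib)
      ultimately show ?thesis
        by simp
    qed
    have w: "2 * (1 + \<i>) * ((1 + \<i>) * (1 + \<i> * u ^ 2) / d) = 4 * \<i> * (1 + \<i> * u ^ 2) / d"
      by (simp add: algebra_simps)
    define A where "A = 4 * \<i> * (1 + \<i> * u ^ 2) / d"
    define Q' where "Q' = 8 * \<i> * (1 - 3 * \<i> * u ^ 2 + 3 * u ^ 4 - \<i> * u ^ 6) / d ^ 2"
    define Q where "Q = 8 * \<i> * u * (1 - \<i> * u ^ 2) / d"
    have "(?E has_field_derivative (Q' * ?B + ?B' * z' * Q - 2 * (1 + \<i>) * ((1 + \<i>) * (1 + \<i> * u ^ 2) / d))) (at u)"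
      using DERIV_diff[OF DERIV_mult[OF q B] DERIV_cmult[OF cb_arcsin_deriv[OF nb(1)]]] 
      unfolding Q'_def Q_def d_def .
    moreover have "Q' * ?B + ?B' * z' * Q - 2 * (1 + \<i>) * ((1 + \<i>) * (1 + \<i> * u ^ 2) / d) = 0"
    proof -
      have "Q' * ?B + ?B' * z' * Q - A = Q' * ?B + (Q * z') * ?B' - A"
        by (simp add: mult_ac)
      also have "\<dots> = Q' * ?B + A * (?z * (4 - ?z) * ?B') - A"
        using e1 unfolding Q_def[symmetric] A_def[symmetric] by (simp add: mult_ac)
      also have "\<dots> = (Q' + A * (?z - 2)) * ?B"
        unfolding ode by (simp add: algebra_simps)
      also have "\<dots> = 0"
        using e2 unfolding Q'_def[symmetric] A_def[symmetric] by simp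
      finally show ?thesis unfolding w A_def .
    qed
    ultimately have "(?E has_field_derivative 0) (at u)" by simp
    then show "(?E has_field_derivative 0) (at u within cball 0 (norm s))"
      by (rule has_field_derivative_at_within)
  qed auto
  then obtain c where c: "\<And>u. u \<in> cball 0 (norm s) \<Longrightarrow> ?E u = c" by blast
  have "?E s = ?E 0" using c[of s] c[of 0] by simp
  then show ?thesis by (simp add: cb_arcsin_def)
qed

lemma cb_series2_cb_arg:
  assumes "norm (s::complex) ^ 4 + 2 * norm s ^ 2 < 1"
  shows "cb_series2 (cb_arg s) = 2 * cb_arcsin s ^ 2"
proof -
  let ?E = "\<lambda>s. cb_series2 (cb_arg s) - 2 * cb_arcsin s ^ 2"
  have "\<exists>c. \<forall>u\<in>cball 0 (norm s). ?E u = c"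
  proof (rule has_field_derivative_zero_constant)
    fix u :: complex assume "u \<in> cball 0 (norm s)"
    then have "norm u ^ 4 + 2 * norm u ^ 2 \<le> norm s ^ 4 + 2 * norm s ^ 2"
      by (intro add_mono mult_left_mono power_mono) auto
    then have u: "norm u ^ 4 + 2 * norm u ^ 2 < 1" using assms by simp
    note nb = cb_arg_domain[OF u]
    define d where "d = 1 - u ^ 4"
    define z' where "z' = 16 * \<i> * u * (1 + u ^ 4) / d ^ 2"
    have d: "d \<noteq> 0" using nb d_def by simp
    have B: "((\<lambda>s. cb_series2 (cb_arg s)) has_field_derivative cb_series1 (cb_arg u) * z') (at u)"
      using DERIV_chain2[OF cb_series2_deriv cb_arg_deriv] nb by (simp add: z'_def d_def)
    have "z' = 8 * \<i> * u * (1 - \<i> * u ^ 2) / d * (2 * (1 + \<i> * u ^ 2) / d)"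
      using d by (simp add: z'_def field_simps eval_nat_numeral)
    then have "cb_series1 (cb_arg u) * z' = (8 * \<i> * u * (1 - \<i> * u ^ 2) / d * cb_series1 (cb_arg u)) * (2 * (1 + \<i> * u ^ 2) / d)"
      by (simp only: mult_ac)
    also have "\<dots> = 2 * (1 + \<i>) * cb_arcsin u * (2 * (1 + \<i> * u ^ 2) / d)"
      by (simp only: cb_series1_cb_arg[OF u, folded d_def])
    finally have "cb_series1 (cb_arg u) * z' - 2 * (2 * cb_arcsin u * ((1 + \<i>) * (1 + \<i> * u ^ 2) / d)) = 0"
      by (simp add: algebra_simps)
    moreover have "(?E has_field_derivative cb_series1 (cb_arg u) * z' - 2 * (2 * cb_arcsin u * ((1 + \<i>) * (1 + \<i> * u ^ 2) / d))) (at u)"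
      by (rule DERIV_cong[OF DERIV_diff[OF B DERIV_cmult[OF DERIV_power[OF cb_arcsin_deriv[OF nb(1)], of 2]]]])
         (simp add: d_def)
    ultimately have "(?E has_field_derivative 0) (at u)" by simp
    then show "(?E has_field_derivative 0) (at u within cball 0 (norm s))"
      by (rule has_field_derivative_at_within)
  qed auto
  then obtain c where c: "\<And>u. u \<in> cball 0 (norm s) \<Longrightarrow> ?E u = c" by blast
  have "?E s = ?E 0" using c[of s] c[of 0] by simp
  then show ?thesis by (simp add: cb_arcsin_def cb_arg_def cb_series2_def)
qed

lemma sums_odd_part:
  fixes a :: "nat \<Rightarrow> complex"
  assumes "(\<lambda>m. a m * (\<i> * X) ^ m) sums p" and "(\<lambda>m. a m * (- (\<i> * X)) ^ m) sums q"
  shows "(\<lambda>n. (-1) ^ n * a (2 * n + 1) * X ^ (2 * n + 1)) sums ((p - q) / (2 * \<i>))"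
proof -
  let ?f = "\<lambda>m. (a m * (\<i> * X) ^ m - a m * (- (\<i> * X)) ^ m) / (2 * \<i>)"
  have "?f sums ((p - q) / (2 * \<i>))"
    by (intro sums_divide sums_diff assms)
  moreover have "strict_mono (\<lambda>n::nat. 2 * n + 1)"
    by (auto simp: strict_mono_def)
  moreover have "?f m = 0" if "m \<notin> range (\<lambda>n. 2 * n + 1)" for m
  proof -
    have "even m" using that by (metis oddE rangeI)
    then show ?thesis by (simp add: power_minus_even)
  qed
  ultimately have "(\<lambda>n. ?f (2 * n + 1)) sums ((p - q) / (2 * \<i>))"
    by (subst sums_mono_reindex)
  also have "(\<lambda>n. ?f (2 * n + 1)) = (\<lambda>n. (-1) ^ n * a (2 * n + 1) * X ^ (2 * n + 1))"
  proof
    fix n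
    have "(- (\<i> * X)) ^ (2 * n + 1) = - ((\<i> * X) ^ (2 * n + 1))"
      by (rule power_minus_odd) simp
    moreover have "(\<i> * X) ^ (2 * n + 1) = \<i> * ((-1) ^ n * X ^ (2 * n + 1))"
    proof -
      have "\<i> ^ (2 * n + 1) = \<i> * (-1) ^ n"
        by (simp add: power_mult)
      then show ?thesis
        by (simp only: power_mult_distrib mult.assoc)
    qed
    ultimately show "?f (2 * n + 1) = (-1) ^ n * a (2 * n + 1) * X ^ (2 * n + 1)"
      by (simp add: algebra_simps)
  qed
  finally show ?thesis .
qed

lemma cb_arg_times_i: "cb_arg (\<i> * s) = - cb_arg s"
  by (simp add: cb_arg_def power_mult_distrib)

lemma cb_arcsin_eq: "cb_arcsin s = Arctan s + \<i> * artanh s"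
  by (simp add: cb_arcsin_def artanh_conv_Arctan flip: mult.assoc)

lemma cb_arcsin_times_i:
  assumes "norm s < 1"
  shows "cb_arcsin (\<i> * s) = \<i> * artanh s - Arctan s"
  using Arctan_minus[OF assms] by (simp add: cb_arcsin_def artanh_conv_Arctan flip: mult.assoc)

lemma sums_cb_coeff2_cb_arg:
  assumes "norm s ^ 4 + 2 * norm s ^ 2 < 1"
  shows "(\<lambda>n. cb_coeff2 n * cb_arg s ^ n) sums (2 * cb_arcsin s ^ 2)"
  using summable_sums[OF summable_cb_coeff2[OF cb_arg_domain(2)[OF assms]]] cb_series2_cb_arg[OF assms]
  by (simp add: cb_series2_def)

lemma sums_cb_coeff1_cb_arg:
  assumes "norm s ^ 4 + 2 * norm s ^ 2 < 1"
  shows "(\<lambda>n. cb_coeff1 n * cb_arg s ^ n) sums (2 * (1 + \<i>) * s * cb_arcsin s / (1 - \<i> * s ^ 2))"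
proof -
  note nb = cb_arg_domain[OF assms]
  have "cb_arg s * cb_series1 (cb_arg s) =
      s / (1 - \<i> * s ^ 2) * (8 * \<i> * s * (1 - \<i> * s ^ 2) / (1 - s ^ 4) * cb_series1 (cb_arg s))"
    using nb(3,4) by (simp add: cb_arg_def power2_eq_square)
  also have "\<dots> = 2 * (1 + \<i>) * s * cb_arcsin s / (1 - \<i> * s ^ 2)"
    unfolding cb_series1_cb_arg[OF assms] by simp
  finally show ?thesis
    using sums_cb_coeff1[OF nb(2)] by simp
qed

lemma sums_cb_coeff0_cb_arg:
  assumes "norm s ^ 4 + 2 * norm s ^ 2 < 1"
  shows "(\<lambda>n. of_nat n * cb_coeff1 n * cb_arg s ^ n) sums
    ((1 - s ^ 4) * (1 + \<i>) * s * cb_arcsin s / (1 - \<i> * s ^ 2) ^ 3 + 2 * \<i> * s ^ 2 / (1 - \<i> * s ^ 2) ^ 2)"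
proof -
  note nb = cb_arg_domain[OF assms]
  let ?G = "cb_series1 (cb_arg s) + cb_arg s * cb_series1' (cb_arg s)"
  let ?a = "1 - \<i> * s ^ 2"
  have H: "cb_arg s * cb_series1 (cb_arg s) = 2 * (1 + \<i>) * s * cb_arcsin s / ?a"
    using sums_unique2[OF sums_cb_coeff1[OF nb(2)] sums_cb_coeff1_cb_arg[OF assms]] .
  have ne: "4 - cb_arg s \<noteq> 0" using nb(2) by auto
  have "(4 - cb_arg s) * (cb_arg s * ?G) = cb_arg s * ((4 - cb_arg s) * ?G)"
    by (simp only: mult_ac)
  also have "\<dots> = 2 * (cb_arg s * cb_series1 (cb_arg s)) + cb_arg s"
    unfolding cb_series1_ode[OF nb(2)] by (simp add: algebra_simps)
  finally have "cb_arg s * ?G = (2 * (2 * (1 + \<i>) * s * cb_arcsin s / ?a) + cb_arg s) / (4 - cb_arg s)"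
    using ne unfolding H by (simp add: eq_divide_eq mult_ac)
  also have "\<dots> = (2 * (2 * (1 + \<i>) * s * cb_arcsin s / ?a) * (1 - s ^ 4) + 8 * \<i> * s ^ 2) / (4 * ?a ^ 2)"
    using nb(3) unfolding nb(6) by (simp add: cb_arg_def add_divide_distrib distrib_right)
  also have "\<dots> = (1 - s ^ 4) * (1 + \<i>) * s * cb_arcsin s / ?a ^ 3 + 2 * \<i> * s ^ 2 / ?a ^ 2"
  proof -
    have "(2 * (2 * c * t * w / a) * d + 8 * \<i> * u) / (4 * a ^ 2) = d * c * t * w / a ^ 3 + 2 * \<i> * u / a ^ 2"
      if "a \<noteq> 0" for a c t w d u :: complex
      using that by (simp add: divide_simps power2_eq_square power3_eq_cube)
    from this[OF nb(4)] show ?thesis .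
  qed
  finally show ?thesis using sums_cb_coeff0(1)[OF nb(2)] by simp
qed

lemma odd_series_closed_forms:
  assumes bound: "norm s ^ 4 + 2 * norm s ^ 2 < 1" and y: "y = s ^ 2" and X: "X = 8 * y / (1 - y ^ 2)"
  shows "(\<lambda>n. (-1) ^ n * cb_coeff2 (2 * n + 1) * X ^ (2 * n + 1)) sums (4 * artanh s * Arctan s)" (is ?th1)
    and "(\<lambda>n. (-1) ^ n * cb_coeff1 (2 * n + 1) * X ^ (2 * n + 1)) sums
      (2 * s * (1 - y ^ 2) / (1 + y ^ 2) * (artanh s / (1 + y) + Arctan s / (1 - y)))" (is ?th2)
    and "(\<lambda>n. (-1) ^ n * (of_nat (2 * n + 1) * cb_coeff1 (2 * n + 1)) * X ^ (2 * n + 1)) sums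
      (2 * y * (1 - y ^ 2) / (1 + y ^ 2) ^ 2
        + (1 + y) * (1 - y) ^ 2 * (y ^ 2 + 4 * y + 1) / (1 + y ^ 2) ^ 3 * s * Arctan s
        + (1 - y) * (1 + y) ^ 2 * (y ^ 2 - 4 * y + 1) / (1 + y ^ 2) ^ 3 * s * artanh s)" (is ?th3)
proof -
  note nb = cb_arg_domain[OF bound]
  have bound': "norm (\<i> * s) ^ 4 + 2 * norm (\<i> * s) ^ 2 < 1"
    using bound by (simp add: norm_mult)
  have s4: "s ^ 4 = y ^ 2" by (simp add: y flip: power_mult)
  have z: "cb_arg s = \<i> * X" by (simp add: cb_arg_def X s4 flip: y)
  have z': "cb_arg (\<i> * s) = - (\<i> * X)" by (simp add: cb_arg_times_i z)
  have isy: "(\<i> * s) ^ 2 = - y" "(\<i> * s) ^ 4 = y ^ 2"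
    using s4 by (simp_all add: power_mult_distrib flip: y)
  define T where "T = Arctan s"
  define A where "A = artanh s"
  define D where "D = 1 + y ^ 2"
  have w: "cb_arcsin s = T + \<i> * A" "cb_arcsin (\<i> * s) = \<i> * A - T"
    using cb_arcsin_times_i[OF nb(1)] by (simp_all add: cb_arcsin_eq T_def A_def)
  have ab: "1 - \<i> * y \<noteq> 0" "1 + \<i> * y \<noteq> 0" using nb(4,5) by (simp_all add: y)
  have Dab: "D = (1 - \<i> * y) * (1 + \<i> * y)"
    by (simp add: D_def algebra_simps power2_eq_square)
  have D: "D \<noteq> 0" unfolding Dab using ab by simp
  have "(1 + y) * (1 - y) \<noteq> 0"
    using nb(3) s4 by (simp add: algebra_simps power2_eq_square)
  then have y1: "1 + y \<noteq> 0" "1 - y \<noteq> 0" by auto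
  have inv1: "u / (1 - \<i> * y) = u * (1 + \<i> * y) / D" "u / (1 + \<i> * y) = u * (1 - \<i> * y) / D" for u
    unfolding Dab using ab by simp_all
  show ?th1
  proof -
    have "(2 * cb_arcsin s ^ 2 - 2 * cb_arcsin (\<i> * s) ^ 2) / (2 * \<i>) = 4 * A * T"
      unfolding w by (simp add: power2_eq_square field_simps)
    then show ?thesis
      using sums_odd_part[OF sums_cb_coeff2_cb_arg[OF bound, unfolded z] sums_cb_coeff2_cb_arg[OF bound', unfolded z']] by (simp add: A_def T_def)
  qed
  show ?th2
  proof -
    have "(2 * (1 + \<i>) * s * (T + \<i> * A) / (1 - \<i> * y) - 2 * (1 + \<i>) * (\<i> * s) * (\<i> * A - T) / (1 + \<i> * y)) / (2 * \<i>) =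
       (2 * (1 + \<i>) * s * (T + \<i> * A) * (1 + \<i> * y) - 2 * (1 + \<i>) * (\<i> * s) * (\<i> * A - T) * (1 - \<i> * y)) / (2 * \<i>) / D"
    proof -
      have "(u / D - v / D) / c = (u - v) / c / D" for u v c
        by (simp add: mult.commute flip: diff_divide_distrib)
      then show ?thesis unfolding inv1 .
    qed
    also have "(2 * (1 + \<i>) * s * (T + \<i> * A) * (1 + \<i> * y) - 2 * (1 + \<i>) * (\<i> * s) * (\<i> * A - T) * (1 - \<i> * y)) / (2 * \<i>) =
       2 * s * (A * (1 - y) + T * (1 + y))"
      by (simp add: field_simps)
    also have "2 * s * (A * (1 - y) + T * (1 + y)) / D = 2 * s * (1 - y ^ 2) / D * (A / (1 + y) + T / (1 - y))"
    proof -
      have "A / (1 + y) + T / (1 - y) = (A * (1 - y) + T * (1 + y)) / (1 - y ^ 2)"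
        using y1 by (simp add: add_frac_eq) (simp add: algebra_simps power2_eq_square)
      moreover have "1 - y ^ 2 \<noteq> 0" using nb(3) s4 by simp
      ultimately show ?thesis by simp
    qed
    finally show ?thesis
      using sums_odd_part[OF sums_cb_coeff1_cb_arg[OF bound, unfolded z] sums_cb_coeff1_cb_arg[OF bound', unfolded z']]
      unfolding isy w by (simp add: A_def T_def D_def flip: y)
  qed
  show ?th3
  proof -
    let ?a = "1 - \<i> * y" and ?b = "1 + \<i> * y"
    have inv3: "u / ?a ^ 3 = u * ?b ^ 3 / D ^ 3" "u / ?b ^ 3 = u * ?a ^ 3 / D ^ 3"
      "u / ?a ^ 2 = u * ?b ^ 2 / D ^ 2" "u / ?b ^ 2 = u * ?a ^ 2 / D ^ 2" for u
      unfolding Dab using ab by (simp_all add: power_mult_distrib)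
    have "(((1 - y ^ 2) * (1 + \<i>) * s * (T + \<i> * A) / ?a ^ 3 + 2 * \<i> * y / ?a ^ 2)
        - ((1 - y ^ 2) * (1 + \<i>) * (\<i> * s) * (\<i> * A - T) / ?b ^ 3 + 2 * \<i> * (- y) / ?b ^ 2)) / (2 * \<i>)
      = ((1 - y ^ 2) * (1 + \<i>) * s * (T + \<i> * A) * ?b ^ 3 - (1 - y ^ 2) * (1 + \<i>) * (\<i> * s) * (\<i> * A - T) * ?a ^ 3) / (2 * \<i>) / D ^ 3
       + (2 * \<i> * y * ?b ^ 2 - 2 * \<i> * (- y) * ?a ^ 2) / (2 * \<i>) / D ^ 2"
    proof -
      have "((p / d + m / e) - (q / d + n / e)) / c = (p - q) / c / d + (m - n) / c / e" for p q m n c d e :: complex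
        by (simp add: add_divide_distrib diff_divide_distrib mult.commute)
      then show ?thesis unfolding inv3 .
    qed
    also have "(2 * \<i> * y * ?b ^ 2 - 2 * \<i> * (- y) * ?a ^ 2) / (2 * \<i>) = 2 * y * (1 - y ^ 2)"
      by (simp add: field_simps power2_eq_square)
    also have "((1 - y ^ 2) * (1 + \<i>) * s * (T + \<i> * A) * ?b ^ 3 - (1 - y ^ 2) * (1 + \<i>) * (\<i> * s) * (\<i> * A - T) * ?a ^ 3) / (2 * \<i>)
       = (1 + y) * (1 - y) ^ 2 * (y ^ 2 + 4 * y + 1) * s * T + (1 - y) * (1 + y) ^ 2 * (y ^ 2 - 4 * y + 1) * s * A"
    proof -
      have 1: "(1 + \<i>) * (?b ^ 3 + \<i> * ?a ^ 3) = 2 * \<i> * ((1 - y) * (y ^ 2 + 4 * y + 1))"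
        by (simp add: algebra_simps power2_eq_square power3_eq_cube)
      have 2: "(1 + \<i>) * (\<i> * ?b ^ 3 + ?a ^ 3) = 2 * \<i> * ((1 + y) * (y ^ 2 - 4 * y + 1))"
        by (simp add: algebra_simps power2_eq_square power3_eq_cube)
      have "(1 - y ^ 2) * (1 + \<i>) * s * (T + \<i> * A) * ?b ^ 3 - (1 - y ^ 2) * (1 + \<i>) * (\<i> * s) * (\<i> * A - T) * ?a ^ 3
        = (1 - y ^ 2) * s * (T * ((1 + \<i>) * (?b ^ 3 + \<i> * ?a ^ 3)) + A * ((1 + \<i>) * (\<i> * ?b ^ 3 + ?a ^ 3)))"
      proof -
        have "c * e * s * (T + \<i> * A) * p - c * e * (\<i> * s) * (\<i> * A - T) * q
          = c * s * (T * (e * (p + \<i> * q)) + A * (e * (\<i> * p + q)))" for c e p q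
          by (simp add: algebra_simps)
        then show ?thesis .
      qed
      also have "\<dots> = (2 * \<i>) * ((1 - y ^ 2) * s * (T * ((1 - y) * (y ^ 2 + 4 * y + 1)) + A * ((1 + y) * (y ^ 2 - 4 * y + 1))))"
        unfolding 1 2 by (simp only: distrib_left mult_ac)
      finally have "((1 - y ^ 2) * (1 + \<i>) * s * (T + \<i> * A) * ?b ^ 3 - (1 - y ^ 2) * (1 + \<i>) * (\<i> * s) * (\<i> * A - T) * ?a ^ 3) / (2 * \<i>)
        = (1 - y ^ 2) * s * (T * ((1 - y) * (y ^ 2 + 4 * y + 1)) + A * ((1 + y) * (y ^ 2 - 4 * y + 1)))"
        by (simp only: nonzero_mult_div_cancel_left) simp
      also have "\<dots> = (1 + y) * (1 - y) ^ 2 * (y ^ 2 + 4 * y + 1) * s * T + (1 - y) * (1 + y) ^ 2 * (y ^ 2 - 4 * y + 1) * s * A"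
      proof -
        have "1 - y ^ 2 = (1 + y) * (1 - y)"
          by (simp add: algebra_simps power2_eq_square)
        moreover have "(1 + y) * (1 - y) * s * (T * ((1 - y) * p) + A * ((1 + y) * q)) =
            (1 + y) * (1 - y) ^ 2 * p * s * T + (1 - y) * (1 + y) ^ 2 * q * s * A" for p q
          by (simp only: distrib_left mult_ac power2_eq_square)
        ultimately show ?thesis by (simp only:)
      qed
      finally show ?thesis .
    qed
    finally show ?thesis
      using sums_odd_part[OF sums_cb_coeff0_cb_arg[OF bound, unfolded z] sums_cb_coeff0_cb_arg[OF bound', unfolded z']]
      unfolding isy s4 w by (simp add: A_def T_def D_def add_divide_distrib add_ac flip: y)
  qed
qed

lemma y_of_properties:
  fixes X y :: real
  assumes "X \<noteq> 0" and y: "y = (sqrt (X\<^sup>2 + 16) - 4) / X"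
  shows "\<bar>y\<bar> < 1" "X = 8 * y / (1 - y\<^sup>2)" "\<bar>X\<bar> < 4 \<Longrightarrow> y\<^sup>2 + 2 * \<bar>y\<bar> < 1"
proof -
  define r where "r = sqrt (X\<^sup>2 + 16)"
  have r2: "r\<^sup>2 = X\<^sup>2 + 16" by (simp add: r_def)
  have "sqrt 16 < r" unfolding r_def using assms by (subst real_sqrt_less_iff) simp
  then have r: "r > 4" by simp
  have X2: "X\<^sup>2 = (r - 4) * (r + 4)" using r2 by (simp add: algebra_simps power2_eq_square)
  have y': "y = X / (r + 4)"
    using r assms X2 unfolding y r_def[symmetric] by (simp add: field_simps power2_eq_square)
  have "y\<^sup>2 = X\<^sup>2 / (r + 4)\<^sup>2"
    by (simp add: y' power_divide)
  then have y2: "y\<^sup>2 = (r - 4) / (r + 4)"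
    using r unfolding X2 by (simp add: power2_eq_square)
  have "y\<^sup>2 < 1" using r unfolding y2 by simp
  then show "\<bar>y\<bar> < 1" by (simp add: abs_square_less_1)
  have "1 - y\<^sup>2 = 8 / (r + 4)" unfolding y2 using r by (simp add: field_simps)
  then show "X = 8 * y / (1 - y\<^sup>2)" using r by (simp add: y')
  have "y\<^sup>2 + 2 * \<bar>y\<bar> = (r - 4 + 2 * \<bar>X\<bar>) / (r + 4)"
    unfolding y2 unfolding y' using r by (simp add: add_divide_distrib)
  then show "y\<^sup>2 + 2 * \<bar>y\<bar> < 1" if "\<bar>X\<bar> < 4" using r that by simp
qed

lemma alternating_Abel_limit:
  fixes a :: "nat \<Rightarrow> real" and f :: "real \<Rightarrow> complex"
  assumes lim: "a \<longlonglongrightarrow> 0" and nonneg: "\<And>n. 0 \<le> a n" and mono: "\<And>n. a (Suc n) \<le> a n"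
    and sums: "\<And>t. 0 < t \<Longrightarrow> t < 1 \<Longrightarrow> (\<lambda>n. complex_of_real ((-1) ^ n * a n * t ^ n)) sums f t"
    and f: "(f \<longlongrightarrow> l) (at_left 1)"
  shows "(\<lambda>n. complex_of_real ((-1) ^ n * a n)) sums l"
proof -
  define P where "P n t = (\<Sum>i<n. (-1) ^ i * (a i * t ^ i))" for n and t :: real
  have ev: "eventually (\<lambda>t. 0 < t \<and> t < 1) (at_left (1::real))"
    using eventually_at_left[of 0 "1::real"] by (auto intro!: exI[of _ 0])
  have P: "((\<lambda>t. P n t) \<longlongrightarrow> P n 1) (at_left 1)" for n
    unfolding P_def by (intro tendsto_intros)
  have bounds: "Im (f t) = 0 \<and> P (2 * n) t \<le> Re (f t) \<and> Re (f t) \<le> P (2 * n + 1) t" if t: "0 < t \<and> t < 1" for n t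
  proof -
    have s: "(\<lambda>n. (-1) ^ n * (a n * t ^ n)) sums Re (f t)"
      using sums_Re[OF sums[of t]] t by (simp add: mult.assoc)
    have i: "(\<lambda>n. 0) sums Im (f t)"
      using sums_Im[OF sums[of t]] t by simp
    have "(\<lambda>n. a n * t ^ n) \<longlonglongrightarrow> 0 * 0"
      by (intro tendsto_mult lim LIMSEQ_power_zero) (use t in auto)
    then have 0: "(\<lambda>n. a n * t ^ n) \<longlonglongrightarrow> 0" by simp
    have 1: "0 \<le> a n * t ^ n" for n using nonneg t by simp
    have 2: "a (Suc n) * t ^ Suc n \<le> a n * t ^ n" for n
      using mono nonneg t by (intro mult_mono power_decreasing) auto
    show ?thesis
      using summable_Leibniz'(2,4)[of "\<lambda>n. a n * t ^ n" n, OF 0 1 2] s i unfolding P_def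
      by (simp add: sums_iff)
  qed
  have "((\<lambda>t. Im (f t)) \<longlongrightarrow> Im l) (at_left 1)"
    by (intro tendsto_Im f)
  moreover have "((\<lambda>t. Im (f t)) \<longlongrightarrow> 0) (at_left 1)"
    by (rule tendsto_eventually) (use ev bounds in \<open>auto elim!: eventually_mono\<close>)
  ultimately have "Im l = 0"
    by (intro tendsto_unique[OF trivial_limit_at_left_real])
  have Re: "((\<lambda>t. Re (f t)) \<longlongrightarrow> Re l) (at_left 1)"
    by (intro tendsto_Re f)
  have lo: "P (2 * n) 1 \<le> Re l" for n
    by (rule tendsto_le[OF trivial_limit_at_left_real Re P[of "2 * n"]]) (use ev bounds in \<open>auto elim!: eventually_mono\<close>)
  have hi: "Re l \<le> P (2 * n + 1) 1" for n
    by (rule tendsto_le[OF trivial_limit_at_left_real P[of "2 * n + 1"] Re]) (use ev bounds in \<open>auto elim!: eventually_mono\<close>)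
  note L = summable_Leibniz'[of a, OF lim nonneg mono]
  have "(\<Sum>i. (-1) ^ i * a i) \<le> Re l"
    by (rule LIMSEQ_le_const2[OF L(3)]) (use lo in \<open>auto simp: P_def\<close>)
  moreover have "Re l \<le> (\<Sum>i. (-1) ^ i * a i)"
    by (rule LIMSEQ_le_const[OF L(5)]) (use hi in \<open>auto simp: P_def\<close>)
  ultimately have "(\<lambda>n. (-1) ^ n * a n) sums Re l"
    using L(1) by (simp add: sums_iff)
  then have "(\<lambda>n. complex_of_real ((-1) ^ n * a n)) sums complex_of_real (Re l)"
    by (rule sums_of_real)
  also have "complex_of_real (Re l) = l"
    using \<open>Im l = 0\<close> by (simp add: complex_eq_iff)
  finally show ?thesis .
qed

text \<open>
  The function \<open>csqrt\<close> is discontinuous on the negative real axis, but not along it.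
\<close>

lemma isCont_csqrt_of_real: "isCont (\<lambda>r. csqrt (complex_of_real r)) r"
proof -
  have "(\<lambda>r. csqrt (complex_of_real r)) =
      (\<lambda>r. complex_of_real (sqrt (max r 0)) + \<i> * complex_of_real (sqrt (max (-r) 0)))"
  proof
    fix r :: real
    show "csqrt (complex_of_real r) =
        complex_of_real (sqrt (max r 0)) + \<i> * complex_of_real (sqrt (max (-r) 0))"
      by (cases "r \<ge> 0") (auto simp: csqrt_of_real_nonneg csqrt_of_real_nonpos max_def)
  qed
  then show ?thesis
    by (simp only:) (intro continuous_intros)
qed

definition cb_scaled :: "nat \<Rightarrow> real" where
  "cb_scaled m = 4 ^ m * norm (cb_coeff1 m)"

lemma cb_scaled_Suc:
  assumes "n > 0"
  shows "cb_scaled (Suc n) * (2 * real n + 1) = 2 * real n * cb_scaled n"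
proof -
  have "norm (2 * (2 * of_nat n + 1) * cb_coeff1 (Suc n)) = norm (of_nat n * cb_coeff1 n)"
    by (simp only: cb_coeff1_Suc[OF assms])
  then have "2 * (norm (2 * of_nat n + 1 :: complex) * norm (cb_coeff1 (Suc n))) = real n * norm (cb_coeff1 n)"
    by (simp only: norm_mult norm_numeral norm_of_nat mult.assoc)
  moreover have "norm (2 * of_nat n + 1 :: complex) = 2 * real n + 1"
    using norm_of_nat[of "2 * n + 1", where 'a = complex] by (simp add: add.commute)
  ultimately have "2 * ((2 * real n + 1) * norm (cb_coeff1 (Suc n))) = real n * norm (cb_coeff1 n)"
    by simp
  then show ?thesis by (simp add: cb_scaled_def mult_ac)
qed

lemma cb_scaled_nonneg: "0 \<le> cb_scaled n"
  by (simp add: cb_scaled_def)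

lemma cb_scaled_decreasing:
  assumes "n > 0"
  shows "cb_scaled (Suc n) \<le> cb_scaled n"
proof -
  have "cb_scaled (Suc n) * (2 * real n + 1) \<le> cb_scaled n * (2 * real n + 1)"
    unfolding cb_scaled_Suc[OF assms] using cb_scaled_nonneg[of n] by (simp add: algebra_simps)
  then show ?thesis by simp
qed

lemma cb_scaled_square_le: "n > 0 \<Longrightarrow> real n * cb_scaled n ^ 2 \<le> 4"
proof (induction n rule: nat_induct_non_zero)
  case 1
  then show ?case by (simp add: cb_scaled_def power2_eq_square norm_divide)
next
  case (Suc n)
  have "real (Suc n) * cb_scaled (Suc n) ^ 2 * (2 * real n + 1) ^ 2 =
      real (Suc n) * (cb_scaled (Suc n) * (2 * real n + 1)) ^ 2"
    by (simp add: power_mult_distrib)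
  also have "\<dots> = (4 * real n * (real n + 1)) * (real n * cb_scaled n ^ 2)"
    unfolding cb_scaled_Suc[OF Suc.hyps] by (simp add: power2_eq_square algebra_simps)
  also have "\<dots> \<le> (2 * real n + 1) ^ 2 * 4"
    using Suc.IH by (intro mult_mono) (auto simp: power2_eq_square algebra_simps cb_scaled_nonneg)
  finally show ?case
    by (simp add: mult.commute[of _ 4])
qed

lemma cb_scaled_tendsto_0: "cb_scaled \<longlonglongrightarrow> 0"
proof -
  have "(\<lambda>n. cb_scaled n ^ 2) \<longlonglongrightarrow> 0"
  proof (rule tendsto_sandwich)
    show "\<forall>\<^sub>F n in sequentially. 0 \<le> cb_scaled n ^ 2" by simp
    show "\<forall>\<^sub>F n in sequentially. cb_scaled n ^ 2 \<le> 4 / real n"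
      using eventually_gt_at_top[of 0]
      by eventually_elim (use cb_scaled_square_le in \<open>auto simp: field_simps\<close>)
    show "(\<lambda>n. 4 / real n) \<longlonglongrightarrow> 0" by (rule lim_const_over_n)
  qed simp
  then show ?thesis by simp
qed

lemma cb_coeff1_conv_cb_scaled: "cb_coeff1 m * 4 ^ m = complex_of_real (cb_scaled m)"
  by (simp add: cb_scaled_def cb_coeff1_def norm_inverse norm_mult)

lemma cb_coeff2_conv_cb_coeff1: "cb_coeff2 m = cb_coeff1 m / of_nat m"
  by (simp add: cb_coeff2_def cb_coeff1_def power2_eq_square divide_inverse)

definition closed_form2 :: "complex \<Rightarrow> complex" where
  "closed_form2 s = 4 * artanh s * Arctan s"

definition closed_form1 :: "complex \<Rightarrow> complex" where
  "closed_form1 s = 2 * s * (1 - (s\<^sup>2)\<^sup>2) / (1 + (s\<^sup>2)\<^sup>2) * (artanh s / (1 + s\<^sup>2) + Arctan s / (1 - s\<^sup>2))"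

lemma isCont_closed_forms:
  assumes "norm s < 1"
  shows "isCont closed_form1 s" "isCont closed_form2 s"
proof -
  have abs: "\<bar>Im s\<bar> < 1" "\<bar>Re s\<bar> < 1"
    using assms abs_Im_le_cmod abs_Re_le_cmod order.strict_trans1 by blast+
  have T: "isCont Arctan s"
    by (rule continuous_at_Arctan) (use abs in auto)
  have "isCont (\<lambda>s. - \<i> * Arctan (\<i> * s)) s"
    by (intro continuous_intros isCont_o2[OF _ continuous_at_Arctan]) (use abs in auto)
  then have A: "isCont artanh s"
    by (simp add: artanh_conv_Arctan [abs_def])
  have n2: "norm (s\<^sup>2) < 1"
    using assms by (simp add: norm_power abs_square_less_1)
  then have "norm ((s\<^sup>2)\<^sup>2) < 1"
    by (subst norm_power) (simp add: abs_square_less_1)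
  with n2 have nz: "1 + s\<^sup>2 \<noteq> 0" "1 - s\<^sup>2 \<noteq> 0" "1 + (s\<^sup>2)\<^sup>2 \<noteq> 0"
    by (auto simp: add_eq_0_iff)
  show "isCont closed_form2 s" unfolding closed_form2_def [abs_def] by (intro continuous_intros T A)
  show "isCont closed_form1 s" unfolding closed_form1_def [abs_def]
    by (intro continuous_intros T A nz)
qed

definition y_of :: "real \<Rightarrow> real" where
  "y_of X = (sqrt (X\<^sup>2 + 16) - 4) / X"

lemma csqrt_y_of:
  assumes "X \<noteq> 0"
  defines "s \<equiv> csqrt (complex_of_real (y_of X))"
  shows "norm s < 1" "s\<^sup>2 = complex_of_real (y_of X)"
    "\<bar>X\<bar> < 4 \<Longrightarrow> norm s ^ 4 + 2 * norm s ^ 2 < 1"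
    "complex_of_real X = 8 * s\<^sup>2 / (1 - (s\<^sup>2)\<^sup>2)"
proof -
  note y = y_of_properties[OF assms(1) y_of_def]
  show s2: "s\<^sup>2 = complex_of_real (y_of X)" by (simp add: s_def)
  have n: "norm s ^ 2 = \<bar>y_of X\<bar>"
    using arg_cong[OF s2, of norm] by (simp add: norm_power)
  then show "norm s < 1"
    using y(1) by (metis abs_norm_cancel abs_square_less_1)
  have "norm s ^ 4 = (norm s ^ 2) ^ 2" by (simp flip: power_mult)
  then show "norm s ^ 4 + 2 * norm s ^ 2 < 1" if "\<bar>X\<bar> < 4"
    using y(3)[OF that] unfolding n by simp
  show "complex_of_real X = 8 * s\<^sup>2 / (1 - (s\<^sup>2)\<^sup>2)"
    unfolding s2 by (subst y(2)) simp
qed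

lemma sums_closed_forms_interior:
  assumes "X \<noteq> 0" "\<bar>X\<bar> < 4"
  defines "s \<equiv> csqrt (complex_of_real (y_of X))"
  shows "(\<lambda>n. (-1) ^ n * cb_coeff2 (2 * n + 1) * complex_of_real X ^ (2 * n + 1)) sums closed_form2 s"
    and "(\<lambda>n. (-1) ^ n * cb_coeff1 (2 * n + 1) * complex_of_real X ^ (2 * n + 1)) sums closed_form1 s"
  using odd_series_closed_forms(1,2)[OF csqrt_y_of(3)[OF assms(1,2)] refl csqrt_y_of(4)[OF assms(1)]]
  unfolding closed_form1_def closed_form2_def s_def .

lemma sums_closed_form_boundary:
  fixes a :: "nat \<Rightarrow> real" and c :: "nat \<Rightarrow> complex" and F :: "complex \<Rightarrow> complex"
  assumes x: "\<bar>x\<bar> = 4"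
    and a: "a \<longlonglongrightarrow> 0" "\<And>n. 0 \<le> a n" "\<And>n. a (Suc n) \<le> a n"
    and c: "\<And>n. c n * 4 ^ (2 * n + 1) = complex_of_real (a n)"
    and F: "\<And>s. norm s < 1 \<Longrightarrow> isCont F s"
    and sums: "\<And>X. X \<noteq> 0 \<Longrightarrow> \<bar>X\<bar> < 4 \<Longrightarrow>
      (\<lambda>n. (-1) ^ n * c n * complex_of_real X ^ (2 * n + 1)) sums F (csqrt (complex_of_real (y_of X)))"
  shows "(\<lambda>n. (-1) ^ n * c n * complex_of_real x ^ (2 * n + 1)) sums F (csqrt (complex_of_real (y_of x)))"
proof -
  define e where "e = x / 4"
  have x0: "x \<noteq> 0" using x by auto
  have xe: "x = 4 * e" by (simp add: e_def)
  have "e = 1 \<or> e = -1" using x by (auto simp: e_def)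
  then have e2: "e\<^sup>2 = 1" and e0: "e \<noteq> 0" by auto
  have x_pow: "c n * complex_of_real x ^ (2 * n + 1) = complex_of_real (e * a n)" for n
  proof -
    have "e ^ (2 * n + 1) = e" by (simp add: power_mult e2)
    then have "complex_of_real x ^ (2 * n + 1) = complex_of_real e * 4 ^ (2 * n + 1)"
      unfolding xe of_real_mult power_mult_distrib
      by (simp only: mult.commute flip: of_real_power) simp
    then have "c n * complex_of_real x ^ (2 * n + 1) = complex_of_real e * (c n * 4 ^ (2 * n + 1))"
      by (simp only: mult_ac)
    then show ?thesis unfolding c by simp
  qed
  let ?f = "\<lambda>t. F (csqrt (complex_of_real (y_of (x * sqrt t)))) / complex_of_real (e * sqrt t)"
  let ?l = "F (csqrt (complex_of_real (y_of x))) / complex_of_real e"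
  have "(\<lambda>n. complex_of_real ((-1) ^ n * a n)) sums ?l"
  proof (rule alternating_Abel_limit[OF a])
    fix t :: real
    assume t: "0 < t" "t < 1"
    have "\<bar>x * sqrt t\<bar> < 4" using t x by (simp add: abs_mult)
    moreover have "x * sqrt t \<noteq> 0" using t x0 by simp
    ultimately have "(\<lambda>n. (-1) ^ n * c n * complex_of_real (x * sqrt t) ^ (2 * n + 1) / complex_of_real (e * sqrt t)) sums ?f t"
      by (intro sums_divide sums)
    also have "(\<lambda>n. (-1) ^ n * c n * complex_of_real (x * sqrt t) ^ (2 * n + 1) / complex_of_real (e * sqrt t)) =
        (\<lambda>n. complex_of_real ((-1) ^ n * a n * t ^ n))"
    proof
      fix n
      have "sqrt t ^ (2 * n + 1) = sqrt t * t ^ n"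
        using t by (simp add: power_mult)
      then have "complex_of_real (x * sqrt t) ^ (2 * n + 1) = complex_of_real x ^ (2 * n + 1) * complex_of_real (sqrt t * t ^ n)"
        by (simp only: of_real_mult power_mult_distrib flip: of_real_power)
      then have "(-1) ^ n * c n * complex_of_real (x * sqrt t) ^ (2 * n + 1) =
          (-1) ^ n * (c n * complex_of_real x ^ (2 * n + 1)) * complex_of_real (sqrt t * t ^ n)"
        by (simp only: mult.assoc)
      also have "\<dots> = complex_of_real ((-1) ^ n * a n * t ^ n) * complex_of_real (e * sqrt t)"
        unfolding x_pow by simp
      finally show "(-1) ^ n * c n * complex_of_real (x * sqrt t) ^ (2 * n + 1) / complex_of_real (e * sqrt t) =
          complex_of_real ((-1) ^ n * a n * t ^ n)"
        using t e0 by simp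
    qed
    finally show "(\<lambda>n. complex_of_real ((-1) ^ n * a n * t ^ n)) sums ?f t" .
  next
    have "isCont (\<lambda>t. y_of (x * sqrt t)) 1"
      unfolding y_of_def using x0 by (intro continuous_intros) auto
    then have "isCont (\<lambda>t. csqrt (complex_of_real (y_of (x * sqrt t)))) 1"
      by (rule isCont_o2) (rule isCont_csqrt_of_real)
    then have "isCont (\<lambda>t. F (csqrt (complex_of_real (y_of (x * sqrt t))))) 1"
      by (rule isCont_o2) (use F csqrt_y_of(1)[OF x0] in simp)
    then have "isCont ?f 1"
      using e0 by (intro continuous_intros) auto
    then have "(?f \<longlongrightarrow> ?f 1) (at_left 1)"
      unfolding isCont_def by (rule filterlim_mono) (simp_all add: at_le)
    then show "(?f \<longlongrightarrow> ?l) (at_left 1)" by simp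
  qed
  then have "(\<lambda>n. complex_of_real ((-1) ^ n * a n) * complex_of_real e) sums (?l * complex_of_real e)"
    by (rule sums_mult2)
  also have "(\<lambda>n. complex_of_real ((-1) ^ n * a n) * complex_of_real e) =
      (\<lambda>n. (-1) ^ n * c n * complex_of_real x ^ (2 * n + 1))"
    by (simp only: mult.assoc x_pow) (simp add: mult_ac)
  finally show ?thesis using e0 by simp
qed

lemma sums_closed_forms:
  assumes "x \<noteq> 0" "\<bar>x\<bar> \<le> 4"
  defines "s \<equiv> csqrt (complex_of_real (y_of x))"
  shows "(\<lambda>n. (-1) ^ n * cb_coeff2 (2 * n + 1) * complex_of_real x ^ (2 * n + 1)) sums closed_form2 s"
    and "(\<lambda>n. (-1) ^ n * cb_coeff1 (2 * n + 1) * complex_of_real x ^ (2 * n + 1)) sums closed_form1 s"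
proof -
  have decr: "cb_scaled (2 * Suc n + 1) \<le> cb_scaled (2 * n + 1)" for n
    using cb_scaled_decreasing[of "2 * n + 1"] cb_scaled_decreasing[of "2 * n + 2"] by simp
  have lim: "(\<lambda>n. cb_scaled (2 * n + 1)) \<longlonglongrightarrow> 0"
    using LIMSEQ_subseq_LIMSEQ[OF cb_scaled_tendsto_0, of "\<lambda>n. 2 * n + 1"]
    by (simp add: strict_mono_def o_def)
  show "(\<lambda>n. (-1) ^ n * cb_coeff1 (2 * n + 1) * complex_of_real x ^ (2 * n + 1)) sums closed_form1 s"
  proof (cases "\<bar>x\<bar> < 4")
    case True
    then show ?thesis unfolding s_def by (intro sums_closed_forms_interior assms)
  next
    case False
    show ?thesis unfolding s_def
    proof (rule sums_closed_form_boundary[OF _ lim cb_scaled_nonneg decr])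
      show "\<bar>x\<bar> = 4" using False assms by simp
    qed (use cb_coeff1_conv_cb_scaled isCont_closed_forms sums_closed_forms_interior in blast)+
  qed
  show "(\<lambda>n. (-1) ^ n * cb_coeff2 (2 * n + 1) * complex_of_real x ^ (2 * n + 1)) sums closed_form2 s"
  proof (cases "\<bar>x\<bar> < 4")
    case True
    then show ?thesis unfolding s_def by (intro sums_closed_forms_interior assms)
  next
    case False
    have le: "cb_scaled (2 * n + 1) / real (2 * n + 1) \<le> cb_scaled (2 * n + 1)" for n
      using cb_scaled_nonneg[of "2 * n + 1"] by (simp add: divide_le_eq distrib_left)
    have lim2: "(\<lambda>n. cb_scaled (2 * n + 1) / real (2 * n + 1)) \<longlonglongrightarrow> 0"
      by (rule tendsto_sandwich[OF _ _ tendsto_const lim]) (use le cb_scaled_nonneg in \<open>auto intro!: always_eventually\<close>)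
    have nonneg2: "0 \<le> cb_scaled (2 * n + 1) / real (2 * n + 1)" for n
      using cb_scaled_nonneg by simp
    have decr2: "cb_scaled (2 * Suc n + 1) / real (2 * Suc n + 1) \<le> cb_scaled (2 * n + 1) / real (2 * n + 1)" for n
      using decr[of n] cb_scaled_nonneg by (intro frac_le) auto
    have conv: "cb_coeff2 (2 * n + 1) * 4 ^ (2 * n + 1) = complex_of_real (cb_scaled (2 * n + 1) / real (2 * n + 1))" for n
      using cb_coeff1_conv_cb_scaled[of "2 * n + 1"] unfolding cb_coeff2_conv_cb_coeff1
      by (simp only: times_divide_eq_left of_real_divide of_real_of_nat_eq)
    show ?thesis unfolding s_def
    proof (rule sums_closed_form_boundary[OF _ lim2 nonneg2 decr2 conv])
      show "\<bar>x\<bar> = 4" using False assms by simp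
    qed (use isCont_closed_forms sums_closed_forms_interior in blast)+
  qed
qed

lemma series_term_conv_cb_coeff:
  fixes x :: real
  shows "complex_of_real ((-1) ^ n / (real (2 * n + 1))\<^sup>2 * inverse (real ((4 * n + 2) choose (2 * n + 1))) * x ^ (2 * n + 1))
      = (-1) ^ n * cb_coeff2 (2 * n + 1) * complex_of_real x ^ (2 * n + 1)"
    and "complex_of_real ((-1) ^ n / real (2 * n + 1) * inverse (real ((4 * n + 2) choose (2 * n + 1))) * x ^ (2 * n + 1))
      = (-1) ^ n * cb_coeff1 (2 * n + 1) * complex_of_real x ^ (2 * n + 1)"
    and "complex_of_real ((-1) ^ n * inverse (real ((4 * n + 2) choose (2 * n + 1))) * x ^ (2 * n + 1))
      = (-1) ^ n * (of_nat (2 * n + 1) * cb_coeff1 (2 * n + 1)) * complex_of_real x ^ (2 * n + 1)"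
proof -
  have m: "4 * n + 2 = 2 * (2 * n + 1)" by simp
  show "complex_of_real ((-1) ^ n / (real (2 * n + 1))\<^sup>2 * inverse (real ((4 * n + 2) choose (2 * n + 1))) * x ^ (2 * n + 1))
      = (-1) ^ n * cb_coeff2 (2 * n + 1) * complex_of_real x ^ (2 * n + 1)"
    unfolding m cb_coeff2_def
    by (simp only: of_real_mult of_real_divide of_real_power of_real_inverse of_real_of_nat_eq of_real_minus of_real_1 divide_inverse inverse_mult_distrib mult.assoc)
  show "complex_of_real ((-1) ^ n / real (2 * n + 1) * inverse (real ((4 * n + 2) choose (2 * n + 1))) * x ^ (2 * n + 1))
      = (-1) ^ n * cb_coeff1 (2 * n + 1) * complex_of_real x ^ (2 * n + 1)"
    unfolding m cb_coeff1_def
    by (simp only: of_real_mult of_real_divide of_real_power of_real_inverse of_real_of_nat_eq of_real_minus of_real_1 divide_inverse inverse_mult_distrib mult.assoc)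
  have "of_nat (2 * n + 1) * cb_coeff1 (2 * n + 1) = inverse (of_nat ((2 * (2 * n + 1)) choose (2 * n + 1)))"
    unfolding cb_coeff1_def inverse_mult_distrib
    by (subst mult.assoc [symmetric], subst right_inverse) (simp_all only: of_nat_eq_0_iff, simp_all)
  then show "complex_of_real ((-1) ^ n * inverse (real ((4 * n + 2) choose (2 * n + 1))) * x ^ (2 * n + 1))
      = (-1) ^ n * (of_nat (2 * n + 1) * cb_coeff1 (2 * n + 1)) * complex_of_real x ^ (2 * n + 1)"
    unfolding m
    by (simp only: of_real_mult of_real_power of_real_inverse of_real_of_nat_eq of_real_minus of_real_1)
qed

theorem theorem9:
  fixes x y :: real
  assumes "0 < \<bar>x\<bar>" and "\<bar>x\<bar> \<le> 4"
    and "y = (sqrt (x\<^sup>2 + 16) - 4) / x"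
  shows
    "(\<lambda>n. complex_of_real
        ((-1) ^ n / (real (2 * n + 1))\<^sup>2 * inverse (real ((4 * n + 2) choose (2 * n + 1))) * x ^ (2 * n + 1)))
      sums (4 * artanh (csqrt (complex_of_real y)) * Arctan (csqrt (complex_of_real y)))
     \<and>
     (\<lambda>n. complex_of_real
        ((-1) ^ n / real (2 * n + 1) * inverse (real ((4 * n + 2) choose (2 * n + 1))) * x ^ (2 * n + 1)))
      sums (2 * csqrt (complex_of_real y) * (1 - (complex_of_real y)\<^sup>2) / (1 + (complex_of_real y)\<^sup>2)
            * (artanh (csqrt (complex_of_real y)) / (1 + complex_of_real y)
               + Arctan (csqrt (complex_of_real y)) / (1 - complex_of_real y)))
     \<and>
     (\<bar>x\<bar> < 4 \<longrightarrow>
      (\<lambda>n. complex_of_real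
         ((-1) ^ n * inverse (real ((4 * n + 2) choose (2 * n + 1))) * x ^ (2 * n + 1)))
       sums (2 * complex_of_real y * (1 - (complex_of_real y)\<^sup>2) / (1 + (complex_of_real y)\<^sup>2) ^ 2
             + (1 + complex_of_real y) * (1 - complex_of_real y)\<^sup>2
                 * ((complex_of_real y)\<^sup>2 + 4 * complex_of_real y + 1) / (1 + (complex_of_real y)\<^sup>2) ^ 3
                 * csqrt (complex_of_real y) * Arctan (csqrt (complex_of_real y))
             + (1 - complex_of_real y) * (1 + complex_of_real y)\<^sup>2
                 * ((complex_of_real y)\<^sup>2 - 4 * complex_of_real y + 1) / (1 + (complex_of_real y)\<^sup>2) ^ 3
                 * csqrt (complex_of_real y) * artanh (csqrt (complex_of_real y))))"
proof -
  have x0: "x \<noteq> 0" using assms(1) by simp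
  have y: "y = y_of x" by (simp add: assms(3) y_of_def)
  note sq = csqrt_y_of(2)[OF x0]
  show ?thesis
    unfolding series_term_conv_cb_coeff y
    using sums_closed_forms[OF x0 assms(2)] odd_series_closed_forms(3)[OF csqrt_y_of(3)[OF x0] refl csqrt_y_of(4)[OF x0]]
    unfolding closed_form1_def closed_form2_def sq by blast
qed

end
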